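(* Let $u,v\in\ell^+$. Let $A(C,C^* )$ and $A^+(C,C^* )$ denote the smallest $A\in[0,\infty]$ such that \[ \|Cx\|_{\ell^\infty(v)}\le A\|C^*x\|_{\ell^\infty(1/u)} \] holds for all $x\in\mathcal D(C^* )$ and for all $x\in\ell^+\cap\mathcal D(C^* )$, respectively. Let $A(C^*,C)$ and $A^+(C^*,C)$ denote the smallest $A\in[0,\infty]$ such that \[ \|C^*x\|_{\ell^\infty(v)}\le A\|Cx\|_{\ell^\infty(1/u)} \] holds for all $x\in\mathcal D(C^* )$ and for all $x\in\ell^+\cap\mathcal D(C^* )$, respectively. Then, taking $u_0=0$, \begin{align*} A(C,C^* )&=\sup_{n\ge1}v_n\Big(u_{n+1}+\frac1n\sum_{k=1}^nu_k\Big);\\ A^+(C,C^* )&=\sup_{n\ge1}\frac{v_n}n\sum_{k=1}^n\min_{1\le j\le k}u_j;\\ A(C^*,C)&=\sup_{n\ge1}v_n\Big(\frac{n-1}nu_{n-1}+\sum_{k=n}^\infty\frac{u_k}{k+1}\Big);\\ A^+(C^*,C)&=\sup_{n\ge1}v_n\sum_{k=n}^\infty\frac1{k(k+1)}\inf_{j\ge k}ju_j. \end{align*}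
   Context: $\ell^+$ is the set of nonnegative real sequences indexed by the positive integers. $(Cx)_n=\frac1n\sum_{k=1}^n x_k$; $(C^*x)_n=\sum_{k=n}^\infty \frac{x_k}{k}$, with domain $\mathcal D(C^* )$ the set of all real sequences $x$ for which $\sum_{k=1}^\infty \frac{x_k}{k}$ converges (possibly conditionally) in $\mathbb R$. For $u,v\in\ell^+$: $\|y\|_{\ell^\infty(v)}=\sup_n|y_n|v_n\in[0,\infty]$ and $\|x\|_{\ell^\infty(1/u)}=\sup_k|x_k|/u_k\in[0,\infty]$, where, if $u_k=0$, $|x_k|/u_k$ is $0$ when $x_k=0$ and $\infty$ when $x_k\neq0$. Conventions: $\infty\cdot0=0$ in the formulas for the constants and in $A\|\cdot\|$ when $A=\infty$ and the norm is $0$; a norm inequality is regarded as holding whenever the norm on its right-hand side is $\infty$ (even if $A=0$). *)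

theory Defs
  imports Complex_Main "HOL-Library.Extended_Nonnegative_Real"
begin

text \<open>Sequences indexed by the positive integers are functions \<open>nat \<Rightarrow> real\<close> whose value
  at \<open>0\<close> is never used.\<close>

definition nonneg_seqs :: "(nat \<Rightarrow> real) set" where
  "nonneg_seqs = {x. \<forall>n\<ge>1. 0 \<le> x n}"

definition Cesaro :: "(nat \<Rightarrow> real) \<Rightarrow> nat \<Rightarrow> real" where
  "Cesaro x n = (1 / real n) * (\<Sum>k=1..n. x k)"

definition Copson :: "(nat \<Rightarrow> real) \<Rightarrow> nat \<Rightarrow> real" where
  "Copson x n = (\<Sum>i. x (n + i) / real (n + i))"

text \<open>The constant \<open>summable\<close> means convergence of the partial sums, so conditional convergence is
  included.\<close>

definition Copson_dom :: "(nat \<Rightarrow> real) set" where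
  "Copson_dom = {x. summable (\<lambda>i. x (1 + i) / real (1 + i))}"

definition norm_weight :: "(nat \<Rightarrow> real) \<Rightarrow> (nat \<Rightarrow> real) \<Rightarrow> ennreal" where
  "norm_weight v y = (SUP n\<in>{1..}. ennreal (\<bar>y n\<bar> * v n))"

definition norm_recip_weight :: "(nat \<Rightarrow> real) \<Rightarrow> (nat \<Rightarrow> real) \<Rightarrow> ennreal" where
  "norm_recip_weight u x =
     (SUP k\<in>{1..}. if u k = 0 then (if x k = 0 then 0 else \<infinity>) else ennreal (\<bar>x k\<bar> / u k))"

text \<open>The constants \<open>A \<in> [0, \<infinity>]\<close> for which
  \<open>norm_weight v (S x) \<le> A * norm_recip_weight u (T x)\<close> holds for all \<open>x \<in> D\<close>.  The inequality
  counts as true when the right-hand norm is infinite, even for \<open>A = 0\<close>; and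
  \<open>\<infinity> * 0 = 0\<close> in \<^typ>\<open>ennreal\<close>.\<close>

definition admissible ::
  "((nat \<Rightarrow> real) \<Rightarrow> nat \<Rightarrow> real) \<Rightarrow> ((nat \<Rightarrow> real) \<Rightarrow> nat \<Rightarrow> real) \<Rightarrow> (nat \<Rightarrow> real) set
     \<Rightarrow> (nat \<Rightarrow> real) \<Rightarrow> (nat \<Rightarrow> real) \<Rightarrow> ennreal set" where
  "admissible S T D u v =
     {A. \<forall>x\<in>D. norm_recip_weight u (T x) = \<infinity> \<or>
                norm_weight v (S x) \<le> A * norm_recip_weight u (T x)}"

definition is_smallest :: "ennreal set \<Rightarrow> ennreal \<Rightarrow> bool" where
  "is_smallest M a \<longleftrightarrow> a \<in> M \<and> (\<forall>b\<in>M. a \<le> b)"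

end

theory Submission
  imports Defs
begin

text \<open>
  The two operators are expressed through each other by summation by parts.  If \<open>y = C\<^sup>* x\<close> then
  \<open>x\<^sub>k = k (y\<^sub>k - y\<^sub>k\<^sub>+\<^sub>1)\<close> and
    \<open>(C x)\<^sub>n = (y\<^sub>1 + \<dots> + y\<^sub>n) / n - y\<^sub>n\<^sub>+\<^sub>1\<close>.
  If \<open>y = C x\<close> then \<open>x\<^sub>k = k y\<^sub>k - (k - 1) y\<^sub>k\<^sub>-\<^sub>1\<close> and
    \<open>(C\<^sup>* x)\<^sub>n = (\<Sum>k\<ge>n. y\<^sub>k / (k + 1)) - (n - 1) / n \<sqdot> y\<^sub>n\<^sub>-\<^sub>1\<close>,
  where the boundary term at infinity vanishes because \<open>C x\<close> tends to \<open>0\<close> on the domain of \<open>C\<^sup>*\<close>.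

  In all four problems the hypothesis is \<open>\<bar>y\<^sub>k\<bar> \<le> M u\<^sub>k\<close> for all \<open>k\<close>, and the value at \<open>n\<close> to
  be bounded is a linear functional of \<open>y\<close> with known coefficients.  Over all \<open>x\<close> the signs of
  the entries of \<open>y\<close> are free, so the best bound sums the absolute values of the coefficients
  against \<open>u\<close>; it is attained (or approached by truncation) at \<open>y\<^sub>k = \<plusminus> u\<^sub>k\<close>.  Over nonnegative
  \<open>x\<close> the single negative term can be dropped, and there is a monotonicity constraint:
  \<open>C\<^sup>* x\<close> decreases and \<open>k (C x)\<^sub>k\<close> increases.  Hence the bound \<open>u\<close> may be replaced by its largest
  decreasing minorant \<open>min {u\<^sub>1, \<dots>, u\<^sub>k}\<close>, respectively by the minorant \<open>inf {j u\<^sub>j | j \<ge> k} / k\<close>,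
  and these minorants, suitably truncated, are themselves values of
  \<open>y\<close> for some nonnegative \<open>x\<close>.
\<close>

section \<open>Reducing a smallest constant to pointwise estimates\<close>

lemma nonneg_seqsD: "u \<in> nonneg_seqs \<Longrightarrow> k \<ge> 1 \<Longrightarrow> 0 \<le> u k"
  by (simp add: nonneg_seqs_def)

lemma norm_recip_weight_le_iff:
  assumes "u \<in> nonneg_seqs" and "0 \<le> M"
  shows "norm_recip_weight u y \<le> ennreal M \<longleftrightarrow> (\<forall>k\<ge>1. \<bar>y k\<bar> \<le> M * u k)"
proof -
  have "(if u k = 0 then (if y k = 0 then 0 else \<infinity>) else ennreal (\<bar>y k\<bar> / u k)) \<le> ennreal M
      \<longleftrightarrow> \<bar>y k\<bar> \<le> M * u k" if "k \<ge> 1" for k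
  proof (cases "u k = 0")
    case False
    then have "u k > 0" using assms(1) that by (force simp: nonneg_seqs_def)
    then show ?thesis using assms(2) by (simp add: ennreal_le_iff divide_le_eq)
  qed (simp add: top_unique)
  then show ?thesis unfolding norm_recip_weight_def SUP_le_iff by auto
qed

text \<open>
  By homogeneity, a smallest constant is found for each index \<open>n\<close> separately, as the extreme value
  of \<open>\<bar>S x n\<bar> * v n\<close> over the unit ball of the norm on the right.  The factor \<open>F n\<close> may be infinite,
  so the upper bound is required for \<open>M = 0\<close> as well, where \<open>\<infinity> * 0 = 0\<close> makes it say that
  \<open>\<bar>S x n\<bar> * v n\<close> is not positive.  The extreme value need not be attained, hence the formulation of
  sharpness with an arbitrary upper bound \<open>B\<close>.
\<close>
lemma is_smallest_admissible_SUP: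
  assumes u: "u \<in> nonneg_seqs"
    and bound: "\<And>x M n. \<lbrakk>x \<in> D; 0 \<le> M; \<forall>k\<ge>1. \<bar>T x k\<bar> \<le> M * u k; n \<ge> 1\<rbrakk>
          \<Longrightarrow> ennreal (\<bar>S x n\<bar> * v n) \<le> F n * ennreal M"
    and sharp: "\<And>n B. \<lbrakk>n \<ge> 1; \<And>x. x \<in> D \<Longrightarrow> (\<forall>k\<ge>1. \<bar>T x k\<bar> \<le> u k) \<Longrightarrow> ennreal (\<bar>S x n\<bar> * v n) \<le> B\<rbrakk>
          \<Longrightarrow> F n \<le> B"
  shows "is_smallest (admissible S T D u v) (SUP n\<in>{1..}. F n)"
  unfolding is_smallest_def
proof (intro conjI ballI)
  show "(SUP n\<in>{1..}. F n) \<in> admissible S T D u v"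
    unfolding admissible_def
  proof (intro CollectI ballI)
    fix x assume x: "x \<in> D"
    let ?N = "norm_recip_weight u (T x)"
    show "?N = \<infinity> \<or> norm_weight v (S x) \<le> (SUP n\<in>{1..}. F n) * ?N"
    proof (cases "?N = \<infinity>")
      case False
      then obtain M where M: "M \<ge> 0" "?N = ennreal M"
        by (cases ?N) auto
      then have le: "\<forall>k\<ge>1. \<bar>T x k\<bar> \<le> M * u k"
        using norm_recip_weight_le_iff[OF u M(1), of "T x"] by simp
      have "ennreal (\<bar>S x n\<bar> * v n) \<le> (SUP n\<in>{1..}. F n) * ennreal M" if "n \<ge> 1" for n
        using bound[OF x M(1) le that]
        by (rule order_trans) (use that in \<open>auto intro!: mult_right_mono SUP_upper\<close>)
      then show ?thesis by (auto simp: norm_weight_def M SUP_le_iff)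
    qed simp
  qed
next
  fix A assume A: "A \<in> admissible S T D u v"
  have "ennreal (\<bar>S x n\<bar> * v n) \<le> A" if "n \<ge> 1" "x \<in> D" "\<forall>k\<ge>1. \<bar>T x k\<bar> \<le> u k" for n x
  proof -
    have N: "norm_recip_weight u (T x) \<le> 1"
      using norm_recip_weight_le_iff[OF u, of 1] that(3) by simp
    then have "norm_weight v (S x) \<le> A * norm_recip_weight u (T x)"
      using A that(2) by (force simp: admissible_def top_unique)
    also have "\<dots> \<le> A" using mult_left_mono[OF N, of A] by simp
    finally show ?thesis using that(1) by (auto simp: norm_weight_def SUP_le_iff)
  qed
  then show "(SUP n\<in>{1..}. F n) \<le> A"
    by (intro SUP_least sharp) auto
qed

section \<open>Expressing each operator through the other\<close>

lemma Copson_sums: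
  assumes "x \<in> Copson_dom" "n \<ge> 1"
  shows "(\<lambda>i. x (n + i) / real (n + i)) sums Copson x n"
proof -
  have "summable (\<lambda>i. x (1 + (i + (n - 1))) / real (1 + (i + (n - 1))))"
    using assms(1) unfolding Copson_dom_def mem_Collect_eq by (rule summable_ignore_initial_segment)
  moreover have "1 + (i + (n - 1)) = n + i" for i using assms(2) by simp
  ultimately have "summable (\<lambda>i. x (n + i) / real (n + i))" by (simp only:)
  then show ?thesis unfolding Copson_def by (rule summable_sums)
qed

lemma Cesaro_nonneg:
  assumes "x \<in> nonneg_seqs"
  shows "0 \<le> Cesaro x n"
  unfolding Cesaro_def using assms by (intro mult_nonneg_nonneg sum_nonneg) (auto simp: nonneg_seqs_def)

lemma Copson_nonneg:
  assumes "x \<in> nonneg_seqs \<inter> Copson_dom" "n \<ge> 1"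
  shows "0 \<le> Copson x n"
  using assms by (intro sums_le[OF _ sums_zero Copson_sums]) (auto simp: nonneg_seqs_def)

lemma Copson_Suc:
  assumes "x \<in> Copson_dom" "n \<ge> 1"
  shows "Copson x n = x n / real n + Copson x (Suc n)"
proof -
  have "(\<lambda>i. x (n + Suc i) / real (n + Suc i)) sums Copson x (Suc n)"
    using Copson_sums[OF assms(1), of "Suc n"] by simp
  then have "(\<lambda>i. x (n + i) / real (n + i)) sums (Copson x (Suc n) + x (n + 0) / real (n + 0))"
    by (rule sums_Suc)
  then show ?thesis using sums_unique2[OF Copson_sums[OF assms]] by fastforce
qed

text \<open>
  Summation by parts applied to \<open>x\<^sub>k = k (y\<^sub>k - y\<^sub>k\<^sub>+\<^sub>1)\<close> with \<open>y = C\<^sup>* x\<close>.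
\<close>
lemma Cesaro_conv_Copson:
  assumes "x \<in> Copson_dom" "n \<ge> 1"
  shows "Cesaro x n = (1 / real n) * (\<Sum>k=1..n. Copson x k) - Copson x (n + 1)"
proof -
  have "(\<Sum>k=1..n. x k) = (\<Sum>k=1..n. Copson x k) - real n * Copson x (n + 1)" for n
  proof (induction n)
    case (Suc n)
    have "x (Suc n) = real (Suc n) * (Copson x (Suc n) - Copson x (Suc (Suc n)))"
      using Copson_Suc[OF assms(1), of "Suc n"] by (simp add: field_simps)
    then show ?case using Suc by (simp add: algebra_simps)
  qed simp
  then show ?thesis using assms(2) by (simp add: Cesaro_def field_simps)
qed

lemma Copson_tendsto_0:
  assumes "x \<in> Copson_dom"
  shows "Copson x \<longlonglongrightarrow> 0"
proof -
  let ?f = "\<lambda>i. x (1 + i) / real (1 + i)"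
  have f: "summable ?f" using assms by (simp add: Copson_dom_def)
  have "Copson x (Suc n) = (\<Sum>i. ?f i) - (\<Sum>i<n. ?f i)" for n
    using suminf_minus_initial_segment[OF f, of n] by (simp add: Copson_def add_ac)
  moreover have "(\<lambda>n. (\<Sum>i. ?f i) - (\<Sum>i<n. ?f i)) \<longlonglongrightarrow> (\<Sum>i. ?f i) - (\<Sum>i. ?f i)"
    by (intro tendsto_intros summable_LIMSEQ f)
  ultimately show ?thesis by (simp flip: filterlim_sequentially_Suc[of "Copson x"])
qed

lemma means_tendsto_0:
  fixes y :: "nat \<Rightarrow> real"
  assumes "y \<longlonglongrightarrow> 0"
  shows "(\<lambda>n. (1 / real n) * (\<Sum>k=1..n. y k)) \<longlonglongrightarrow> 0"
proof (rule LIMSEQ_I)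
  fix e :: real assume e: "e > 0"
  obtain N where N: "\<And>k. k \<ge> N \<Longrightarrow> \<bar>y k\<bar> < e / 2"
    using LIMSEQ_D[OF assms, of "e / 2"] e by auto
  define K where "K = (\<Sum>k=1..N. \<bar>y k\<bar>)"
  obtain N' where N': "real N' > 2 * K / e" using reals_Archimedean2 by blast
  have "norm ((1 / real n) * (\<Sum>k=1..n. y k) - 0) < e" if n: "n \<ge> max 1 (max N N')" for n
  proof -
    have "{1..n} = {1..N} \<union> {N<..n}" using n by auto
    then have "(\<Sum>k=1..n. \<bar>y k\<bar>) = K + (\<Sum>k\<in>{N<..n}. \<bar>y k\<bar>)"
      unfolding K_def by (simp add: sum.union_disjoint ivl_disj_int)
    also have "\<dots> \<le> K + real (card {N<..n}) * (e / 2)"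
      using N by (intro add_left_mono sum_bounded_above) (auto intro: less_imp_le)
    also have "\<dots> \<le> K + real n * (e / 2)" using e by simp
    also have "\<dots> < real n * e"
    proof -
      have "2 * K / e < real n" using N' n by simp
      then show ?thesis using e by (simp add: field_simps)
    qed
    finally have "\<bar>\<Sum>k=1..n. y k\<bar> < real n * e" using sum_abs[of y "{1..n}"] by linarith
    then show ?thesis using n by (simp add: abs_mult field_simps)
  qed
  then show "\<exists>m. \<forall>n\<ge>m. norm ((1 / real n) * (\<Sum>k=1..n. y k) - 0) < e" by blast
qed

text \<open>
  This is Kronecker's lemma for the series of \<open>x\<^sub>k / k\<close>: summation by parts exhibits \<open>C x\<close> as the
  difference of the means of a null sequence and a shift of that null sequence.
\<close>
lemma Cesaro_tendsto_0:
  assumes "x \<in> Copson_dom"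
  shows "Cesaro x \<longlonglongrightarrow> 0"
proof -
  have "(\<lambda>n. (1 / real n) * (\<Sum>k=1..n. Copson x k) - Copson x (n + 1)) \<longlonglongrightarrow> 0 - 0"
    using Copson_tendsto_0[OF assms] by (intro tendsto_diff means_tendsto_0 LIMSEQ_ignore_initial_segment)
  moreover have "\<forall>\<^sub>F n in sequentially.
      (1 / real n) * (\<Sum>k=1..n. Copson x k) - Copson x (n + 1) = Cesaro x n"
    unfolding eventually_sequentially using Cesaro_conv_Copson[OF assms] by (intro exI[of _ 1]) simp
  ultimately have "Cesaro x \<longlonglongrightarrow> 0 - 0"
    by (rule Lim_transform_eventually)
  then show ?thesis by simp
qed

text \<open>
  With \<open>w\<^sub>k = (k - 1) / k \<sqdot> (C x)\<^sub>k\<^sub>-\<^sub>1\<close> one has \<open>x\<^sub>k / k = (C x)\<^sub>k - w\<^sub>k\<close> and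
  \<open>w\<^sub>k\<^sub>+\<^sub>1 = (C x)\<^sub>k - (C x)\<^sub>k / (k + 1)\<close>, so the two series differ by one that telescopes.  For
  \<open>n = 1\<close> the meaningless entry \<open>(C x)\<^sub>0\<close> is multiplied by \<open>0\<close>.
\<close>
lemma Cesaro_sums_Copson:
  assumes x: "x \<in> Copson_dom" and n: "n \<ge> 1"
  shows "(\<lambda>i. Cesaro x (n + i) / (real (n + i) + 1)) sums
           (Copson x n + (real n - 1) / real n * Cesaro x (n - 1))"
proof -
  define w where "w k = (real k - 1) / real k * Cesaro x (k - 1)" for k
  have "Cesaro x k / (real k + 1) = x k / real k - (w (Suc k) - w k)" if k: "k \<ge> 1" for k
  proof -
    have "x k = real k * Cesaro x k - (real k - 1) * Cesaro x (k - 1)"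
      using k by (cases k) (auto simp: Cesaro_def)
    then have "x k / real k = Cesaro x k - w k"
      using k by (simp add: w_def field_simps)
    moreover have "w (Suc k) = Cesaro x k - Cesaro x k / (real k + 1)"
      by (simp add: w_def field_simps)
    ultimately show ?thesis by simp
  qed
  then have *: "Cesaro x (n + i) / (real (n + i) + 1)
      = x (n + i) / real (n + i) - (w (n + Suc i) - w (n + i))" for i
    using n by (simp only: add_Suc_right trans_le_add1)
  have "(\<lambda>k. real k / real (Suc k) * Cesaro x k) \<longlonglongrightarrow> 1 * 0"
    by (intro tendsto_mult LIMSEQ_n_over_Suc_n Cesaro_tendsto_0 x)
  then have "w \<longlonglongrightarrow> 0"
    by (simp add: w_def flip: filterlim_sequentially_Suc[of w])
  then have "(\<lambda>i. w (n + i)) \<longlonglongrightarrow> 0"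
    using LIMSEQ_ignore_initial_segment[of w 0 n] by (simp add: add.commute)
  then have "(\<lambda>i. w (n + Suc i) - w (n + i)) sums (0 - w (n + 0))"
    by (rule telescope_sums)
  from sums_diff[OF Copson_sums[OF x n] this] show ?thesis
    unfolding * by (simp add: w_def)
qed

section \<open>Prescribing the values of the operators\<close>

text \<open>
  Every null sequence is a value of \<open>C\<^sup>*\<close>; this supplies the extremal sequences for bounds in
  terms of \<open>C\<^sup>* x\<close>.
\<close>
lemma Copson_differences:
  assumes "y \<longlonglongrightarrow> 0"
  defines "x \<equiv> \<lambda>k. real k * (y k - y (Suc k))"
  shows "x \<in> Copson_dom" and "n \<ge> 1 \<Longrightarrow> Copson x n = y n"
proof -
  have sums: "(\<lambda>i. x (n + i) / real (n + i)) sums y n" if "n \<ge> 1" for n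
  proof -
    have "(\<lambda>i. y (n + i)) \<longlonglongrightarrow> 0"
      using LIMSEQ_ignore_initial_segment[OF assms(1), of n] by (simp add: add.commute)
    then have "(\<lambda>i. y (n + i) - y (n + Suc i)) sums (y (n + 0) - 0)"
      by (rule telescope_sums')
    then show ?thesis using that by (simp add: x_def)
  qed
  show "x \<in> Copson_dom" using sums[of 1] by (auto simp: Copson_dom_def sums_iff)
  show "Copson x n = y n" if "n \<ge> 1" using sums[OF that] by (simp add: Copson_def sums_iff)
qed

text \<open>
  For bounds in terms of \<open>C x\<close> it is more convenient to prescribe the partial sums
  \<open>s\<^sub>k = k (C x)\<^sub>k\<close>.
\<close>
lemma Cesaro_differences:
  fixes s :: "nat \<Rightarrow> real"
  assumes "s 0 = 0"
  shows "Cesaro (\<lambda>k. s k - s (k - 1)) n = s n / real n"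
proof -
  have "(\<Sum>k=1..n. s k - s (k - 1)) = s n"
    using assms by (induction n) auto
  then show ?thesis by (simp add: Cesaro_def)
qed

lemma differences_in_Copson_dom:
  fixes s :: "nat \<Rightarrow> real"
  assumes "\<And>k. k \<ge> m \<Longrightarrow> s k = c"
  shows "(\<lambda>k. s k - s (k - 1)) \<in> Copson_dom"
proof -
  have "(s (1 + i) - s (1 + i - 1)) / real (1 + i) = 0" if "i \<notin> {..<m}" for i
    using that assms[of i] assms[of "Suc i"] by simp
  then show ?thesis unfolding Copson_dom_def mem_Collect_eq by (intro summable_finite[of "{..<m}"]) auto
qed

section \<open>Estimates for possibly divergent majorants\<close>

text \<open>
  The series of \<open>f\<close> may converge conditionally while the one of \<open>g\<close> diverges, so the estimate
  passes through partial sums instead of absolute convergence.  For \<open>M = 0\<close> it gives \<open>s = 0\<close> even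
  when the series on the right is infinite.
\<close>
lemma ennreal_sums_le:
  fixes f g :: "nat \<Rightarrow> real"
  assumes "f sums s" and le: "\<And>i. \<bar>f i\<bar> \<le> M * g i" and "0 \<le> M" and "\<And>i. 0 \<le> g i"
  shows "ennreal \<bar>s\<bar> \<le> ennreal M * (\<Sum>i. ennreal (g i))"
proof (rule LIMSEQ_le_const2)
  show "(\<lambda>m. ennreal \<bar>\<Sum>i<m. f i\<bar>) \<longlonglongrightarrow> ennreal \<bar>s\<bar>"
    using assms(1) by (intro tendsto_ennrealI tendsto_rabs) (simp add: sums_def)
  have "ennreal \<bar>\<Sum>i<m. f i\<bar> \<le> ennreal M * (\<Sum>i. ennreal (g i))" for m
  proof -
    have "\<bar>\<Sum>i<m. f i\<bar> \<le> M * (\<Sum>i<m. g i)"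
      unfolding sum_distrib_left by (intro order_trans[OF sum_abs] sum_mono le)
    then have "ennreal \<bar>\<Sum>i<m. f i\<bar> \<le> ennreal (M * (\<Sum>i<m. g i))"
      by (rule ennreal_leI)
    also have "\<dots> = ennreal M * (\<Sum>i<m. ennreal (g i))"
      using assms(3,4) by (simp add: ennreal_mult sum_nonneg)
    also have "\<dots> \<le> ennreal M * (\<Sum>i. ennreal (g i))"
      by (intro mult_left_mono sum_le_suminf) auto
    finally show ?thesis .
  qed
  then show "\<exists>N. \<forall>m\<ge>N. ennreal \<bar>\<Sum>i<m. f i\<bar> \<le> ennreal M * (\<Sum>i. ennreal (g i))" by blast
qed

text \<open>
  Extremal sequences for bounds by infinite series have to be truncated; this passes to the limit
  in the truncation.
\<close>
lemma ennreal_mult_add_suminf_le: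
  fixes g :: "nat \<Rightarrow> real"
  assumes nonneg: "0 \<le> c" "0 \<le> a" "\<And>i. 0 \<le> g i"
    and le: "\<And>m. ennreal (c * (a + (\<Sum>i<m. g i))) \<le> B"
  shows "ennreal c * (ennreal a + (\<Sum>i. ennreal (g i))) \<le> B"
proof (rule LIMSEQ_le_const2)
  show "(\<lambda>m. ennreal c * (ennreal a + (\<Sum>i<m. ennreal (g i))))
      \<longlonglongrightarrow> ennreal c * (ennreal a + (\<Sum>i. ennreal (g i)))"
    by (intro ennreal_tendsto_cmult tendsto_add tendsto_const summable_LIMSEQ summableI) auto
  have "ennreal c * (ennreal a + (\<Sum>i<m. ennreal (g i))) = ennreal (c * (a + (\<Sum>i<m. g i)))" for m
    using nonneg by (simp add: ennreal_mult sum_nonneg)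
  then show "\<exists>N. \<forall>m\<ge>N. ennreal c * (ennreal a + (\<Sum>i<m. ennreal (g i))) \<le> B"
    using le by simp
qed

section \<open>Bounding Cesaro means by Copson sums\<close>

lemma smallest_constant_Cesaro_Copson:
  assumes u: "u \<in> nonneg_seqs" and v: "v \<in> nonneg_seqs"
  shows "is_smallest (admissible Cesaro Copson Copson_dom u v)
           (SUP n\<in>{1..}. ennreal (v n * (u (n + 1) + (1 / real n) * (\<Sum>k=1..n. u k))))"
proof (rule is_smallest_admissible_SUP[OF u])
  note u0 = nonneg_seqsD[OF u] and v0 = nonneg_seqsD[OF v]
  fix x M and n :: nat
  assume x: "x \<in> Copson_dom" and M: "0 \<le> M" and le: "\<forall>k\<ge>1. \<bar>Copson x k\<bar> \<le> M * u k" and n: "n \<ge> 1"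
  have "\<bar>\<Sum>k=1..n. Copson x k\<bar> \<le> (\<Sum>k=1..n. M * u k)"
    using le by (intro order_trans[OF sum_abs] sum_mono) auto
  then have "(1 / real n) * \<bar>\<Sum>k=1..n. Copson x k\<bar> \<le> (1 / real n) * (M * (\<Sum>k=1..n. u k))"
    by (intro mult_left_mono) (auto simp: sum_distrib_left)
  moreover have "\<bar>Copson x (n + 1)\<bar> \<le> M * u (n + 1)" using le by simp
  ultimately have "\<bar>Cesaro x n\<bar> \<le> M * (u (n + 1) + (1 / real n) * (\<Sum>k=1..n. u k))"
    using abs_triangle_ineq4[of "(1 / real n) * (\<Sum>k=1..n. Copson x k)" "Copson x (n + 1)"]
    unfolding Cesaro_conv_Copson[OF x n] by (simp add: abs_mult algebra_simps)
  then have "\<bar>Cesaro x n\<bar> * v n \<le> M * (u (n + 1) + (1 / real n) * (\<Sum>k=1..n. u k)) * v n"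
    using v0[OF n] by (rule mult_right_mono)
  then show "ennreal (\<bar>Cesaro x n\<bar> * v n)
      \<le> ennreal (v n * (u (n + 1) + (1 / real n) * (\<Sum>k=1..n. u k))) * ennreal M"
    using M u0 v0[OF n] by (subst ennreal_mult[symmetric])
      (auto simp: ac_simps intro!: ennreal_leI mult_nonneg_nonneg add_nonneg_nonneg divide_nonneg_nonneg sum_nonneg)
next
  note u0 = nonneg_seqsD[OF u] and v0 = nonneg_seqsD[OF v]
  fix n :: nat and B
  assume n: "n \<ge> 1"
    and B: "\<And>x. x \<in> Copson_dom \<Longrightarrow> \<forall>k\<ge>1. \<bar>Copson x k\<bar> \<le> u k \<Longrightarrow> ennreal (\<bar>Cesaro x n\<bar> * v n) \<le> B"
  \<comment> \<open>The sign at \<open>n + 1\<close> is opposite because \<open>(C\<^sup>* x)\<^sub>n\<^sub>+\<^sub>1\<close> enters \<open>(C x)\<^sub>n\<close> with a minus sign.\<close>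
  define y where "y k = (if k \<le> n then u k else if k = n + 1 then - u k else 0)" for k
  define x where "x k = real k * (y k - y (Suc k))" for k
  have "y \<longlonglongrightarrow> 0"
    by (rule tendsto_eventually) (auto simp: y_def eventually_sequentially intro!: exI[of _ "n + 2"])
  note x = Copson_differences[OF this, folded x_def]
  have "ennreal (\<bar>Cesaro x n\<bar> * v n) \<le> B"
    using u0 by (intro B) (auto simp: x y_def)
  moreover have "Cesaro x n = u (n + 1) + (1 / real n) * (\<Sum>k=1..n. u k)"
    unfolding Cesaro_conv_Copson[OF x(1) n] by (simp add: x(2) y_def)
  moreover have "0 \<le> u (n + 1) + (1 / real n) * (\<Sum>k=1..n. u k)"
    using u0 by (intro add_nonneg_nonneg mult_nonneg_nonneg sum_nonneg) auto
  ultimately show "ennreal (v n * (u (n + 1) + (1 / real n) * (\<Sum>k=1..n. u k))) \<le> B"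
    by (simp add: mult.commute)
qed

text \<open>
  For \<open>x \<ge> 0\<close> the sequence \<open>C\<^sup>* x\<close> decreases, so a bound by \<open>u\<close> is a bound by its running minimum.
\<close>
lemma smallest_constant_Cesaro_Copson_nonneg:
  assumes u: "u \<in> nonneg_seqs" and v: "v \<in> nonneg_seqs"
  shows "is_smallest (admissible Cesaro Copson (nonneg_seqs \<inter> Copson_dom) u v)
           (SUP n\<in>{1..}. ennreal ((v n / real n) * (\<Sum>k=1..n. Min (u ` {1..k}))))"
proof (rule is_smallest_admissible_SUP[OF u])
  note u0 = nonneg_seqsD[OF u] and v0 = nonneg_seqsD[OF v]
  have m0: "0 \<le> Min (u ` {1..k})" if "k \<ge> 1" for k
    using that u0 by (intro Min.boundedI) auto
  fix x M and n :: nat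
  assume x': "x \<in> nonneg_seqs \<inter> Copson_dom" and M: "0 \<le> M"
    and le: "\<forall>k\<ge>1. \<bar>Copson x k\<bar> \<le> M * u k" and n: "n \<ge> 1"
  from x' have x0: "k \<ge> 1 \<Longrightarrow> 0 \<le> x k" and x: "x \<in> Copson_dom" for k by (auto intro: nonneg_seqsD)
  have decreasing: "Copson x k \<le> Copson x j" if "1 \<le> j" "j \<le> k" for j k
    using that(2)
  proof (induction k rule: dec_induct)
    case (step i)
    then show ?case using Copson_Suc[OF x, of i] x0[of i] that(1)
      by (smt (verit) divide_nonneg_nonneg of_nat_0_le_iff le_trans)
  qed simp
  have Min_le: "Copson x k \<le> M * Min (u ` {1..k})" if "k \<ge> 1" for k
  proof -
    have "Min (u ` {1..k}) \<in> u ` {1..k}" using that by (intro Min_in) auto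
    then obtain j where "1 \<le> j" "j \<le> k" and j: "Min (u ` {1..k}) = u j" by auto
    then have "Copson x k \<le> \<bar>Copson x j\<bar>" using decreasing[of j k] by simp
    also have "\<dots> \<le> M * u j" using le \<open>1 \<le> j\<close> by simp
    finally show ?thesis unfolding j .
  qed
  have "Cesaro x n \<le> (1 / real n) * (\<Sum>k=1..n. Copson x k)"
    unfolding Cesaro_conv_Copson[OF x n] using Copson_nonneg[OF x', of "n + 1"] by simp
  also have "\<dots> \<le> (1 / real n) * (\<Sum>k=1..n. M * Min (u ` {1..k}))"
    by (intro mult_left_mono sum_mono Min_le) auto
  finally have "Cesaro x n \<le> (1 / real n) * (M * (\<Sum>k=1..n. Min (u ` {1..k})))"
    by (simp add: sum_distrib_left)
  moreover have "0 \<le> Cesaro x n" using x' by (simp add: Cesaro_nonneg)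
  ultimately have "\<bar>Cesaro x n\<bar> * v n \<le> (1 / real n) * (M * (\<Sum>k=1..n. Min (u ` {1..k}))) * v n"
    using v0[OF n] by (intro mult_right_mono) auto
  then have "\<bar>Cesaro x n\<bar> * v n \<le> (v n / real n) * (\<Sum>k=1..n. Min (u ` {1..k})) * M"
    by (simp add: ac_simps)
  then show "ennreal (\<bar>Cesaro x n\<bar> * v n)
      \<le> ennreal ((v n / real n) * (\<Sum>k=1..n. Min (u ` {1..k}))) * ennreal M"
    using M m0 v0[OF n] by (subst ennreal_mult[symmetric])
      (auto simp del: Min_ge_iff intro!: ennreal_leI divide_nonneg_nonneg mult_nonneg_nonneg sum_nonneg)
next
  note u0 = nonneg_seqsD[OF u] and v0 = nonneg_seqsD[OF v]
  have m0: "0 \<le> Min (u ` {1..k})" if "k \<ge> 1" for k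
    using that u0 by (intro Min.boundedI) auto
  have m_le: "Min (u ` {1..k}) \<le> u k" if "k \<ge> 1" for k
    using that by (intro Min_le) auto
  have m_dec: "Min (u ` {1..Suc k}) \<le> Min (u ` {1..k})" if "k \<ge> 1" for k
    using that by (intro Min_antimono) auto
  fix n :: nat and B
  assume n: "n \<ge> 1"
    and B: "\<And>x. x \<in> nonneg_seqs \<inter> Copson_dom \<Longrightarrow> \<forall>k\<ge>1. \<bar>Copson x k\<bar> \<le> u k
              \<Longrightarrow> ennreal (\<bar>Cesaro x n\<bar> * v n) \<le> B"
  \<comment> \<open>The drop to \<open>0\<close> after \<open>n\<close> keeps \<open>y\<close> decreasing and removes the negative term at \<open>n + 1\<close>.\<close>
  define y where "y k = (if k \<le> n then Min (u ` {1..k}) else 0)" for k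
  define x where "x k = real k * (y k - y (Suc k))" for k
  have "y \<longlonglongrightarrow> 0"
    by (rule tendsto_eventually) (auto simp: y_def eventually_sequentially intro!: exI[of _ "n + 1"])
  note x = Copson_differences[OF this, folded x_def]
  have "x \<in> nonneg_seqs"
    using m0 m_dec by (auto simp: nonneg_seqs_def x_def y_def intro!: mult_nonneg_nonneg)
  then have "ennreal (\<bar>Cesaro x n\<bar> * v n) \<le> B"
    using u0 m0 m_le x(1) by (intro B) (auto simp: x(2) y_def)
  moreover have "Cesaro x n = (1 / real n) * (\<Sum>k=1..n. Min (u ` {1..k}))"
    unfolding Cesaro_conv_Copson[OF x(1) n] by (simp add: x(2) y_def)
  moreover have "0 \<le> (\<Sum>k=1..n. Min (u ` {1..k}))"
    using m0 by (intro sum_nonneg) auto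
  ultimately show "ennreal ((v n / real n) * (\<Sum>k=1..n. Min (u ` {1..k}))) \<le> B"
    by (simp add: ac_simps)
qed

section \<open>Bounding Copson sums by Cesaro means\<close>

lemma smallest_constant_Copson_Cesaro:
  assumes u: "u \<in> nonneg_seqs" and v: "v \<in> nonneg_seqs"
  shows "is_smallest (admissible Copson Cesaro Copson_dom u v)
           (SUP n\<in>{1..}. ennreal (v n) *
              (ennreal ((real n - 1) / real n * (u(0 := 0)) (n - 1))
               + (\<Sum>i. ennreal (u (n + i) / (real (n + i) + 1)))))"
proof (rule is_smallest_admissible_SUP[OF u])
  note u0 = nonneg_seqsD[OF u] and v0 = nonneg_seqsD[OF v]
  fix x M and n :: nat
  assume x: "x \<in> Copson_dom" and M: "0 \<le> M" and le: "\<forall>k\<ge>1. \<bar>Cesaro x k\<bar> \<le> M * u k" and n: "n \<ge> 1"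
  define a where "a = (real n - 1) / real n * (u(0 := 0)) (n - 1)"
  define b where "b = (real n - 1) / real n * Cesaro x (n - 1)"
  let ?U = "\<Sum>i. ennreal (u (n + i) / (real (n + i) + 1))"
  have a0: "0 \<le> a" using u0[of "n - 1"] n by (auto simp: a_def)
  have "\<bar>Cesaro x (n - 1)\<bar> \<le> M * (u(0 := 0)) (n - 1)"
  proof (cases "n = 1")
    case True
    then show ?thesis by (simp add: Cesaro_def)
  next
    case False
    then have "1 \<le> n - 1" using n by simp
    with le False show ?thesis using n by simp
  qed
  from mult_left_mono[OF this, of "(real n - 1) / real n"] have b: "\<bar>b\<bar> \<le> M * a"
    using n by (simp add: a_def b_def abs_mult mult.left_commute)
  have "ennreal \<bar>Copson x n + b\<bar> \<le> ennreal M * ?U"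
    unfolding b_def
  proof (rule ennreal_sums_le[OF Cesaro_sums_Copson[OF x n] _ M])
    fix i
    show "0 \<le> u (n + i) / (real (n + i) + 1)" using u0 n by simp
    show "\<bar>Cesaro x (n + i) / (real (n + i) + 1)\<bar> \<le> M * (u (n + i) / (real (n + i) + 1))"
      using divide_right_mono[of "\<bar>Cesaro x (n + i)\<bar>" "M * u (n + i)" "real (n + i) + 1"] le n by simp
  qed
  moreover have "ennreal \<bar>Copson x n\<bar> \<le> ennreal (M * a) + ennreal \<bar>Copson x n + b\<bar>"
  proof -
    have "\<bar>Copson x n\<bar> \<le> M * a + \<bar>Copson x n + b\<bar>" using b by linarith
    then have "ennreal \<bar>Copson x n\<bar> \<le> ennreal (M * a + \<bar>Copson x n + b\<bar>)"
      by (rule ennreal_leI)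
    also have "\<dots> = ennreal (M * a) + ennreal \<bar>Copson x n + b\<bar>"
      using a0 M by (intro ennreal_plus) auto
    finally show ?thesis .
  qed
  ultimately have "ennreal \<bar>Copson x n\<bar> \<le> ennreal (M * a) + ennreal M * ?U"
    by (rule order_trans[OF _ add_left_mono, rotated])
  also have "\<dots> = ennreal M * (ennreal a + ?U)"
    using M a0 by (simp add: ennreal_mult distrib_left)
  finally have "ennreal \<bar>Copson x n\<bar> * ennreal (v n) \<le> ennreal M * (ennreal a + ?U) * ennreal (v n)"
    by (rule mult_right_mono) simp
  then show "ennreal (\<bar>Copson x n\<bar> * v n) \<le> ennreal (v n) *
      (ennreal ((real n - 1) / real n * (u(0 := 0)) (n - 1)) + ?U) * ennreal M"
    unfolding a_def using v0[OF n] by (simp add: ennreal_mult ac_simps)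
next
  note u0 = nonneg_seqsD[OF u] and v0 = nonneg_seqsD[OF v]
  fix n :: nat and B
  assume n: "n \<ge> 1"
    and B: "\<And>x. x \<in> Copson_dom \<Longrightarrow> \<forall>k\<ge>1. \<bar>Cesaro x k\<bar> \<le> u k \<Longrightarrow> ennreal (\<bar>Copson x n\<bar> * v n) \<le> B"
  let ?a = "(real n - 1) / real n * (u(0 := 0)) (n - 1)"
  have a0: "0 \<le> ?a" using u0[of "n - 1"] n by auto
  show "ennreal (v n) * (ennreal ?a + (\<Sum>i. ennreal (u (n + i) / (real (n + i) + 1)))) \<le> B"
  proof (rule ennreal_mult_add_suminf_le)
    fix m :: nat
    \<comment> \<open>The sign at \<open>n - 1\<close> is opposite to match the negative coefficient of \<open>(C x)\<^sub>n\<^sub>-\<^sub>1\<close>; the cut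
      at \<open>n + m\<close> makes \<open>x\<close> finitely supported, hence summable even when the majorant diverges.\<close>
    define y where "y k = (if k = n - 1 then - (u(0 := 0)) k else if k \<in> {n..<n + m} then u k else 0)" for k
    define x where "x k = real k * y k - real (k - 1) * y (k - 1)" for k
    have y: "Cesaro x k = y k" if "k \<ge> 1" for k
      using Cesaro_differences[of "\<lambda>k. real k * y k" k] that by (simp add: x_def[abs_def])
    have x: "x \<in> Copson_dom"
      using differences_in_Copson_dom[of "n + m" "\<lambda>k. real k * y k" 0] n
      by (simp add: x_def[abs_def] y_def)
    have "(\<lambda>i. Cesaro x (n + i) / (real (n + i) + 1)) sums
        (\<Sum>i<m. Cesaro x (n + i) / (real (n + i) + 1))"
      by (rule sums_finite) (use n in \<open>auto simp: y y_def\<close>)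
    then have "Copson x n + (real n - 1) / real n * Cesaro x (n - 1)
        = (\<Sum>i<m. Cesaro x (n + i) / (real (n + i) + 1))"
      using sums_unique2[OF Cesaro_sums_Copson[OF x n]] by simp
    also have "\<dots> = (\<Sum>i<m. u (n + i) / (real (n + i) + 1))"
      using n by (intro sum.cong) (auto simp: y y_def)
    moreover have "(real n - 1) / real n * Cesaro x (n - 1) = - ?a"
      using n by (cases "n = 1") (auto simp: y y_def)
    ultimately have "Copson x n = ?a + (\<Sum>i<m. u (n + i) / (real (n + i) + 1))" by simp
    moreover have "0 \<le> (\<Sum>i<m. u (n + i) / (real (n + i) + 1))"
      using u0 n by (intro sum_nonneg) auto
    moreover have "ennreal (\<bar>Copson x n\<bar> * v n) \<le> B"
      using x u0 by (intro B) (auto simp: y y_def)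
    ultimately show "ennreal (v n * (?a + (\<Sum>i<m. u (n + i) / (real (n + i) + 1)))) \<le> B"
      using a0 by (simp add: mult.commute)
  qed (use u0 v0 n a0 in auto)
qed

text \<open>
  For \<open>x \<ge> 0\<close> the partial sums \<open>k (C x)\<^sub>k\<close> increase, so each of them is bounded by every later
  \<open>M j u\<^sub>j\<close> and thus by \<open>M\<close> times the infimum \<open>g k\<close> of these.
\<close>
lemma smallest_constant_Copson_Cesaro_nonneg:
  assumes u: "u \<in> nonneg_seqs" and v: "v \<in> nonneg_seqs"
  shows "is_smallest (admissible Copson Cesaro (nonneg_seqs \<inter> Copson_dom) u v)
           (SUP n\<in>{1..}. ennreal (v n) *
              (\<Sum>i. ennreal (1 / (real (n + i) * (real (n + i) + 1))
                        * (INF j\<in>{n + i..}. real j * u j))))"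
proof -
  note u0 = nonneg_seqsD[OF u] and v0 = nonneg_seqsD[OF v]
  define g where "g k = (INF j\<in>{k..}. real j * u j)" for k
  have bdd: "bdd_below ((\<lambda>j. real j * u j) ` {k..})" for k
  proof (rule bdd_belowI2)
    show "0 \<le> real j * u j" for j using u0[of j] by (cases j) auto
  qed
  have g0: "0 \<le> g k" for k
    unfolding g_def
  proof (rule cINF_greatest)
    show "0 \<le> real j * u j" for j using u0[of j] by (cases j) auto
  qed simp
  have g_le: "g k \<le> real j * u j" if "k \<le> j" for k j
    unfolding g_def using bdd that by (intro cINF_lower) auto
  have g_mono: "g k \<le> g l" if "k \<le> l" for k l
    unfolding g_def using bdd that by (intro cINF_superset_mono) auto
  have "is_smallest (admissible Copson Cesaro (nonneg_seqs \<inter> Copson_dom) u v)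
           (SUP n\<in>{1..}. ennreal (v n) *
              (\<Sum>i. ennreal (1 / (real (n + i) * (real (n + i) + 1)) * g (n + i))))"
  proof (rule is_smallest_admissible_SUP[OF u])
    fix x M and n :: nat
    assume x': "x \<in> nonneg_seqs \<inter> Copson_dom" and M: "0 \<le> M"
      and le: "\<forall>k\<ge>1. \<bar>Cesaro x k\<bar> \<le> M * u k" and n: "n \<ge> 1"
    let ?U = "\<Sum>i. ennreal (1 / (real (n + i) * (real (n + i) + 1)) * g (n + i))"
    from x' have x0: "k \<ge> 1 \<Longrightarrow> 0 \<le> x k" and x: "x \<in> Copson_dom" for k by (auto intro: nonneg_seqsD)
    have C0: "0 \<le> Cesaro x k" for k using x' by (simp add: Cesaro_nonneg)
    have partial_le: "real k * Cesaro x k \<le> M * g k" if k: "k \<ge> 1" for k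
    proof -
      have *: "real k * Cesaro x k \<le> M * (real j * u j)" if "k \<le> j" for j
      proof -
        have "real k * Cesaro x k = (\<Sum>i=1..k. x i)" using k by (simp add: Cesaro_def)
        also have "\<dots> \<le> (\<Sum>i=1..j. x i)" using that x0 by (intro sum_mono2) auto
        also have "\<dots> = real j * Cesaro x j" using k that by (simp add: Cesaro_def)
        also have "\<dots> \<le> real j * (M * u j)"
          using le k that by (intro mult_left_mono) (auto intro: order_trans[OF abs_ge_self])
        finally show ?thesis by (simp add: ac_simps)
      qed
      show ?thesis
      \<comment> \<open>Dividing by \<open>M\<close> brings the estimate into the form required of a lower bound of the infimum.\<close>
      proof (cases "M = 0")
        case True
        then show ?thesis using *[of k] by simp
      next
        case False
        then have "real k * Cesaro x k / M \<le> g k"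
          unfolding g_def using * M by (intro cINF_greatest) (auto simp: field_simps)
        then show ?thesis using False M by (simp add: field_simps)
      qed
    qed
    have "ennreal \<bar>Copson x n + (real n - 1) / real n * Cesaro x (n - 1)\<bar> \<le> ennreal M * ?U"
    proof (rule ennreal_sums_le[OF Cesaro_sums_Copson[OF x n] _ M])
      fix i
      show "0 \<le> 1 / (real (n + i) * (real (n + i) + 1)) * g (n + i)" using g0 by simp
      define k where "k = n + i"
      have k: "k \<ge> 1" using n by (simp add: k_def)
      have "Cesaro x k / (real k + 1) \<le> M * (1 / (real k * (real k + 1)) * g k)"
        using divide_right_mono[OF partial_le[OF k], of "real k * (real k + 1)"] k by simp
      then show "\<bar>Cesaro x (n + i) / (real (n + i) + 1)\<bar>
          \<le> M * (1 / (real (n + i) * (real (n + i) + 1)) * g (n + i))"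
        using C0[of k] by (simp add: k_def)
    qed
    moreover have "\<bar>Copson x n\<bar> \<le> \<bar>Copson x n + (real n - 1) / real n * Cesaro x (n - 1)\<bar>"
      using Copson_nonneg[OF x' n] C0[of "n - 1"] n by simp
    ultimately have "ennreal \<bar>Copson x n\<bar> \<le> ennreal M * ?U"
      by (rule order_trans[OF ennreal_leI, rotated])
    then have "ennreal \<bar>Copson x n\<bar> * ennreal (v n) \<le> ennreal M * ?U * ennreal (v n)"
      by (rule mult_right_mono) simp
    then show "ennreal (\<bar>Copson x n\<bar> * v n) \<le> ennreal (v n) * ?U * ennreal M"
      using v0[OF n] by (simp add: ennreal_mult ac_simps)
  next
    fix n :: nat and B
    assume n: "n \<ge> 1"
      and B: "\<And>x. x \<in> nonneg_seqs \<inter> Copson_dom \<Longrightarrow> \<forall>k\<ge>1. \<bar>Cesaro x k\<bar> \<le> u k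
                \<Longrightarrow> ennreal (\<bar>Copson x n\<bar> * v n) \<le> B"
    let ?h = "\<lambda>i. 1 / (real (n + i) * (real (n + i) + 1)) * g (n + i)"
    have "ennreal (v n) * (ennreal 0 + (\<Sum>i. ennreal (?h i))) \<le> B"
    proof (rule ennreal_mult_add_suminf_le)
      fix m :: nat
      \<comment> \<open>Partial sums equal to \<open>g\<close> from \<open>n\<close> on would be extremal, but the resulting \<open>x\<close> need not lie
        in the domain of \<open>C\<^sup>*\<close>; freezing them at \<open>n + m\<close> makes \<open>x\<close> finitely supported and preserves
        monotonicity.  Starting at \<open>0\<close> removes the negative term at \<open>n - 1\<close>.\<close>
      define s where "s k = (if k < n then 0 else g (min k (n + m)))" for k
      define x where "x k = s k - s (k - 1)" for k
      have s_mono: "s k \<le> s l" if "k \<le> l" for k l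
        using that g0 by (auto simp: s_def intro!: g_mono)
      have C: "Cesaro x k = s k / real k" for k
        unfolding x_def using n by (intro Cesaro_differences) (simp add: s_def)
      have x: "x \<in> Copson_dom"
        unfolding x_def by (rule differences_in_Copson_dom[of "n + m" _ "g (n + m)"]) (auto simp: s_def)
      have xpos: "x \<in> nonneg_seqs"
        using s_mono by (auto simp: x_def nonneg_seqs_def)
      have s_le: "0 \<le> s k" "s k \<le> real k * u k" if "k \<ge> 1" for k
        using g0 u0[OF that] g_le[of "min k (n + m)" k] by (auto simp: s_def)
      have le: "\<forall>k\<ge>1. \<bar>Cesaro x k\<bar> \<le> u k"
        using s_le by (auto simp: C field_simps)
      have "(\<Sum>i<m. ?h i) = (\<Sum>i<m. Cesaro x (n + i) / (real (n + i) + 1))"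
        by (intro sum.cong) (auto simp: C s_def)
      also have "\<dots> \<le> (\<Sum>i. Cesaro x (n + i) / (real (n + i) + 1))"
        using Cesaro_sums_Copson[OF x n] s_le n by (intro sum_le_suminf) (auto simp: sums_iff C)
      also have "\<dots> = Copson x n"
      proof -
        have "(real n - 1) / real n * Cesaro x (n - 1) = 0" using n by (simp add: C s_def)
        then show ?thesis using Cesaro_sums_Copson[OF x n] by (simp add: sums_iff)
      qed
      finally have "v n * (0 + (\<Sum>i<m. ?h i)) \<le> \<bar>Copson x n\<bar> * v n"
        using mult_right_mono[of "\<Sum>i<m. ?h i" "\<bar>Copson x n\<bar>" "v n"] v0[OF n]
        by (simp add: mult.commute)
      moreover have "ennreal (\<bar>Copson x n\<bar> * v n) \<le> B"
        using x xpos le by (intro B) auto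
      ultimately show "ennreal (v n * (0 + (\<Sum>i<m. ?h i))) \<le> B"
        by (rule order_trans[OF ennreal_leI])
    qed (use v0 n g0 in auto)
    then show "ennreal (v n) * (\<Sum>i. ennreal (?h i)) \<le> B" by simp
  qed
  then show ?thesis unfolding g_def .
qed

theorem theorem4p1:
  fixes u v :: "nat \<Rightarrow> real"
  assumes "u \<in> nonneg_seqs" and "v \<in> nonneg_seqs"
  shows "is_smallest (admissible Cesaro Copson Copson_dom u v)
           (SUP n\<in>{1..}. ennreal (v n * (u (n + 1) + (1 / real n) * (\<Sum>k=1..n. u k))))
       \<and> is_smallest (admissible Cesaro Copson (nonneg_seqs \<inter> Copson_dom) u v)
           (SUP n\<in>{1..}. ennreal ((v n / real n) * (\<Sum>k=1..n. Min (u ` {1..k}))))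
       \<and> is_smallest (admissible Copson Cesaro Copson_dom u v)
           (SUP n\<in>{1..}. ennreal (v n) *
              (ennreal ((real n - 1) / real n * (u(0 := 0)) (n - 1))
               + (\<Sum>i. ennreal (u (n + i) / (real (n + i) + 1)))))
       \<and> is_smallest (admissible Copson Cesaro (nonneg_seqs \<inter> Copson_dom) u v)
           (SUP n\<in>{1..}. ennreal (v n) *
              (\<Sum>i. ennreal (1 / (real (n + i) * (real (n + i) + 1))
                        * (INF j\<in>{n + i..}. real j * u j))))"
  using smallest_constant_Cesaro_Copson[OF assms] smallest_constant_Cesaro_Copson_nonneg[OF assms]
    smallest_constant_Copson_Cesaro[OF assms] smallest_constant_Copson_Cesaro_nonneg[OF assms]
  by (intro conjI)

end
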